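(* Let $G$ be a locally compact étale groupoid with Hausdorff unit space $G^0$, and let $S$ be the $*$-semigroup of continuous functions $a:\mathrm{dom}(a)\to\mathbb{D}\setminus\{0\}$ vanishing at infinity on open bisections $\mathrm{dom}(a)\subseteq G$. Let $\mathcal{U}(S)$ be the space of ultrafilters of $S$ with respect to the relation $a\precsim b\Leftrightarrow\mathrm{dom}(a)\subseteq b^{-1}[\mathbb{T}]$, with the topology generated by the sets $\mathcal{U}_a=\{U\in\mathcal{U}(S):a\in U\}$, $a\in S$. Then \[g\mapsto S_g=\{a\in S:g\in\mathrm{int}(a^{-1}[\mathbb{T}])\}\] is a homeomorphism from $G$ onto $\mathcal{U}(S)$. This map is also a groupoid isomorphism, in the sense that for all $g,h\in G$ with $g^*g=hh^*$, \[S_{g^*}=(S_g)^*\qquad\text{and}\qquad S_{gh}=(S_gS_h)^{\precsim}=\{a\in S:\exists b\in S_g\ \exists c\in S_h\ (bc\precsim a)\}.\]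
   Context: The inverse of an element $g$ of a groupoid is written $g^*$; a product $gh$ is defined iff $g^*g=hh^*$; $G^0$ is the set of units. For $O,N\subseteq G$, $O^*=\{g^*:g\in O\}$ and $ON=\{gh:g\in O,h\in N,\ gh\text{ defined}\}$. An étale groupoid is a topological groupoid (continuous inverse and product) whose product is an open map and whose unit space $G^0$ is open in $G$ (equivalently, the source map $g\mapsto g^*g$ is a local homeomorphism). Locally compact means every point has a neighbourhood base of compact sets; $G$ itself need not be Hausdorff. A bisection is a subset $O\subseteq G$ with $OO^*\cup O^*O\subseteq G^0$. $\mathbb{D}=\{\alpha\in\mathbb{C}:|\alpha|\le1\}$, $\mathbb{T}=\{\alpha\in\mathbb{C}:|\alpha|=1\}$. $S$ is the set of all functions $a$ such that $\mathrm{dom}(a)$ is an open bisection of $G$ (possibly empty), $a:\mathrm{dom}(a)\to\mathbb{D}\setminus\{0\}$ is continuous, and $\{g\in\mathrm{dom}(a):|a(g)|\ge\epsilon\}$ is compact for every $\epsilon>0$. Involution and product on $S$: $\mathrm{dom}(a^* )=\mathrm{dom}(a)^*$, $a^*(g)=\overline{a(g^* )}$; $\mathrm{dom}(ab)=\mathrm{dom}(a)\mathrm{dom}(b)$ and $ab(gh)=a(g)b(h)$ for $g\in\mathrm{dom}(a)$, $h\in\mathrm{dom}(b)$ with $g^*g=hh^*$. For $T\subseteq S$, $T^*=\{t^*:t\in T\}$; $\mathrm{int}$ is interior in $G$. A filter is a non-empty $T\subseteq S$ such that for all $a,b\in S$: $a,b\in T$ iff there is $c\in T$ with $c\precsim a$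 and $c\precsim b$. An ultrafilter is a filter $T\neq S$ which is maximal (with respect to inclusion) among filters different from $S$. *)

theory Defs
  imports "HOL-Analysis.Analysis"
begin

section \<open>Etale groupoids\<close>

text \<open>
  The groupoid \<open>G\<close> is the topological space \<open>arrows G\<close>; it may be empty and need not be Hausdorff.
  Multiplication is a total HOL function whose values matter only on composable pairs.
\<close>

record 'g top_groupoid =
  topol :: "'g topology"
  mult  :: "'g \<Rightarrow> 'g \<Rightarrow> 'g"  (infixl "\<cdot>\<index>" 70)
  star  :: "'g \<Rightarrow> 'g"  ("_\<^sup>\<star>\<index>" [1000] 999)

abbreviation arrows :: "'g top_groupoid \<Rightarrow> 'g set" where
  "arrows G \<equiv> topspace (topol G)"

definition composable :: "'g top_groupoid \<Rightarrow> 'g \<Rightarrow> 'g \<Rightarrow> bool" where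
  "composable G g h \<longleftrightarrow>
     g \<in> arrows G \<and> h \<in> arrows G \<and> g\<^sup>\<star>\<^bsub>G\<^esub> \<cdot>\<^bsub>G\<^esub> g = h \<cdot>\<^bsub>G\<^esub> h\<^sup>\<star>\<^bsub>G\<^esub>"

definition units :: "'g top_groupoid \<Rightarrow> 'g set" where
  "units G = {g\<^sup>\<star>\<^bsub>G\<^esub> \<cdot>\<^bsub>G\<^esub> g |g. g \<in> arrows G}"

text \<open>
  The usual axioms for a groupoid given by a partial product and an inverse.  Since the domain of
  the product is here determined by \<open>g\<^sup>\<star> \<cdot> g = h \<cdot> h\<^sup>\<star>\<close>, the axiom that \<open>(g \<cdot> h) \<cdot> k\<close> and
  \<open>g \<cdot> (h \<cdot> k)\<close> are defined as soon as \<open>g \<cdot> h\<close> and \<open>h \<cdot> k\<close> are is expressed by saying that \<open>g \<cdot> h\<close>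
  has the source of \<open>h\<close> and the range of \<open>g\<close>.
\<close>

locale groupoid =
  fixes G :: "'g top_groupoid" (structure)
  assumes star_closed: "g \<in> arrows G \<Longrightarrow> g\<^sup>\<star> \<in> arrows G"
    and star_star: "g \<in> arrows G \<Longrightarrow> (g\<^sup>\<star>)\<^sup>\<star> = g"
    and mult_closed: "composable G g h \<Longrightarrow> g \<cdot> h \<in> arrows G"
    and mult_source: "composable G g h \<Longrightarrow> (g \<cdot> h)\<^sup>\<star> \<cdot> (g \<cdot> h) = h\<^sup>\<star> \<cdot> h"
    and mult_range: "composable G g h \<Longrightarrow> (g \<cdot> h) \<cdot> (g \<cdot> h)\<^sup>\<star> = g \<cdot> g\<^sup>\<star>"
    and mult_assoc: "composable G g h \<Longrightarrow> composable G h k \<Longrightarrow> (g \<cdot> h) \<cdot> k = g \<cdot> (h \<cdot> k)"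
    and cancel_left: "composable G g h \<Longrightarrow> g\<^sup>\<star> \<cdot> (g \<cdot> h) = h"
    and cancel_right: "composable G g h \<Longrightarrow> (g \<cdot> h) \<cdot> h\<^sup>\<star> = g"

definition composable_pairs :: "'g top_groupoid \<Rightarrow> ('g \<times> 'g) topology" where
  "composable_pairs G =
     subtopology (prod_topology (topol G) (topol G)) {(g, h). composable G g h}"

locale topological_groupoid = groupoid +
  assumes continuous_star: "continuous_map (topol G) (topol G) (\<lambda>g. g\<^sup>\<star>)"
    and continuous_mult: "continuous_map (composable_pairs G) (topol G) (\<lambda>(g, h). g \<cdot> h)"

locale etale_groupoid = topological_groupoid +
  assumes open_mult: "open_map (composable_pairs G) (topol G) (\<lambda>(g, h). g \<cdot> h)"
    and open_units: "openin (topol G) (units G)"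

definition set_star :: "'g top_groupoid \<Rightarrow> 'g set \<Rightarrow> 'g set" where
  "set_star G A = {g\<^sup>\<star>\<^bsub>G\<^esub> |g. g \<in> A}"

definition set_mult :: "'g top_groupoid \<Rightarrow> 'g set \<Rightarrow> 'g set \<Rightarrow> 'g set" where
  "set_mult G A B = {g \<cdot>\<^bsub>G\<^esub> h |g h. g \<in> A \<and> h \<in> B \<and> composable G g h}"

definition bisection :: "'g top_groupoid \<Rightarrow> 'g set \<Rightarrow> bool" where
  "bisection G A \<longleftrightarrow>
     A \<subseteq> arrows G \<and> set_mult G A (set_star G A) \<union> set_mult G (set_star G A) A \<subseteq> units G"


section \<open>The semigroup of functions on open bisections\<close>

text \<open>A function together with its domain is a partial map; it is \<open>None\<close> off its domain.\<close>

definition preimage :: "('g \<rightharpoonup> complex) \<Rightarrow> complex set \<Rightarrow> 'g set" where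
  "preimage a C = {g. \<exists>z\<in>C. a g = Some z}"

definition SG :: "'g top_groupoid \<Rightarrow> ('g \<rightharpoonup> complex) set" where
  "SG G = {a.
     openin (topol G) (dom a) \<and> bisection G (dom a) \<and>
     ran a \<subseteq> cball 0 1 - {0} \<and>
     continuous_map (subtopology (topol G) (dom a)) euclidean (\<lambda>g. the (a g)) \<and>
     (\<forall>e>0. compactin (topol G) {g \<in> dom a. e \<le> cmod (the (a g))})}"

definition fstar :: "'g top_groupoid \<Rightarrow> ('g \<rightharpoonup> complex) \<Rightarrow> ('g \<rightharpoonup> complex)" where
  "fstar G a = (\<lambda>g. if g \<in> set_star G (dom a) then Some (cnj (the (a (g\<^sup>\<star>\<^bsub>G\<^esub>)))) else None)"

text \<open>
  The described value is unique when the domains are bisections; see \<open>fmult_apply\<close> below.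
\<close>

definition fmult ::
    "'g top_groupoid \<Rightarrow> ('g \<rightharpoonup> complex) \<Rightarrow> ('g \<rightharpoonup> complex) \<Rightarrow> ('g \<rightharpoonup> complex)" where
  "fmult G a b = (\<lambda>k. if k \<in> set_mult G (dom a) (dom b)
     then Some (THE z. \<exists>g\<in>dom a. \<exists>h\<in>dom b.
            composable G g h \<and> k = g \<cdot>\<^bsub>G\<^esub> h \<and> z = the (a g) * the (b h))
     else None)"

no_notation lepoll (infixl "\<lesssim>" 50)

definition dominated :: "('g \<rightharpoonup> complex) \<Rightarrow> ('g \<rightharpoonup> complex) \<Rightarrow> bool"  (infix "\<lesssim>" 50) where
  "a \<lesssim> b \<longleftrightarrow> dom a \<subseteq> preimage b (sphere 0 1)"

definition Fstar :: "'g top_groupoid \<Rightarrow> ('g \<rightharpoonup> complex) set \<Rightarrow> ('g \<rightharpoonup> complex) set" where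
  "Fstar G T = {fstar G t |t. t \<in> T}"

definition Fmult ::
    "'g top_groupoid \<Rightarrow> ('g \<rightharpoonup> complex) set \<Rightarrow> ('g \<rightharpoonup> complex) set \<Rightarrow> ('g \<rightharpoonup> complex) set" where
  "Fmult G T U = {fmult G t u |t u. t \<in> T \<and> u \<in> U}"

definition up_closure :: "'g top_groupoid \<Rightarrow> ('g \<rightharpoonup> complex) set \<Rightarrow> ('g \<rightharpoonup> complex) set" where
  "up_closure G T = {a \<in> SG G. \<exists>t\<in>T. t \<lesssim> a}"


section \<open>Ultrafilters\<close>

definition is_filter :: "'g top_groupoid \<Rightarrow> ('g \<rightharpoonup> complex) set \<Rightarrow> bool" where
  "is_filter G T \<longleftrightarrow> T \<noteq> {} \<and> T \<subseteq> SG G \<and>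
     (\<forall>a\<in>SG G. \<forall>b\<in>SG G. a \<in> T \<and> b \<in> T \<longleftrightarrow> (\<exists>c\<in>T. c \<lesssim> a \<and> c \<lesssim> b))"

definition ultrafilters :: "'g top_groupoid \<Rightarrow> ('g \<rightharpoonup> complex) set set" where
  "ultrafilters G = {U. is_filter G U \<and> U \<noteq> SG G \<and>
     (\<forall>T. is_filter G T \<and> T \<noteq> SG G \<and> U \<subseteq> T \<longrightarrow> T = U)}"

definition ultrafilter_space :: "'g top_groupoid \<Rightarrow> ('g \<rightharpoonup> complex) set topology" where
  "ultrafilter_space G = topology_generated_by {{U \<in> ultrafilters G. a \<in> U} |a. a \<in> SG G}"

definition S_at :: "'g top_groupoid \<Rightarrow> 'g \<Rightarrow> ('g \<rightharpoonup> complex) set" where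
  "S_at G g = {a \<in> SG G. g \<in> topol G interior_of preimage a (sphere 0 1)}"


section \<open>Sanity checks for the definitions\<close>

lemma topspace_ultrafilter_space: "topspace (ultrafilter_space G) = ultrafilters G"
proof (intro equalityI subsetI)
  fix U assume "U \<in> topspace (ultrafilter_space G)"
  then show "U \<in> ultrafilters G"
    by (auto simp: ultrafilter_space_def)
next
  fix U assume U: "U \<in> ultrafilters G"
  then have "is_filter G U"
    by (simp add: ultrafilters_def)
  then obtain a where "a \<in> SG G" "a \<in> U"
    unfolding is_filter_def by blast
  then show "U \<in> topspace (ultrafilter_space G)"
    using U by (auto simp: ultrafilter_space_def)
qed

lemma dom_fmult: "dom (fmult G a b) = set_mult G (dom a) (dom b)"
  by (auto simp: fmult_def dom_def)

lemma dom_fstar: "dom (fstar G a) = set_star G (dom a)"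
  by (auto simp: fstar_def dom_def)

context groupoid
begin

lemma composable_iff:
  "composable G g h \<longleftrightarrow> g \<in> arrows G \<and> h \<in> arrows G \<and> g\<^sup>\<star> \<cdot> g = h \<cdot> h\<^sup>\<star>"
  by (simp add: composable_def)

lemma mult_unit:
  assumes "composable G g e" "e \<in> units G"
  shows "g \<cdot> e = g"
proof -
  obtain k where k: "k \<in> arrows G" "e = k\<^sup>\<star> \<cdot> k"
    using assms(2) by (auto simp: units_def)
  have "composable G (k\<^sup>\<star>) k"
    using k by (simp add: composable_iff star_closed star_star)
  then have "e \<cdot> e\<^sup>\<star> = e"
    using mult_range[of "k\<^sup>\<star>" k] k by (simp add: star_star)
  then have e: "e = g\<^sup>\<star> \<cdot> g"
    using assms(1) by (simp add: composable_iff)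
  have g: "g \<in> arrows G"
    using assms(1) by (simp add: composable_iff)
  then have "composable G (g\<^sup>\<star>) g"
    by (simp add: composable_iff star_closed star_star)
  then show ?thesis
    using cancel_left[of "g\<^sup>\<star>" g] g e by (simp add: star_star)
qed

lemma bisection_factors_unique:
  assumes A: "bisection G A" "g \<in> A" "g' \<in> A"
    and c: "composable G g h" "composable G g' h'" "g \<cdot> h = g' \<cdot> h'"
  shows "g = g'" "h = h'"
proof -
  have G: "g \<in> arrows G" "g' \<in> arrows G"
    using c by (auto simp: composable_iff)
  have "g \<cdot> g\<^sup>\<star> = g' \<cdot> g'\<^sup>\<star>"
    using mult_range[OF c(1)] mult_range[OF c(2)] c(3) by simp
  then have c1: "composable G (g\<^sup>\<star>) g'"
    using G by (simp add: composable_iff star_closed star_star)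
  then have u: "g\<^sup>\<star> \<cdot> g' \<in> units G"
    using A unfolding bisection_def set_mult_def set_star_def by blast
  have "composable G g (g\<^sup>\<star> \<cdot> g')"
    using mult_range[OF c1] mult_closed[OF c1] G by (simp add: composable_iff star_star)
  then have "g \<cdot> (g\<^sup>\<star> \<cdot> g') = g"
    using u by (rule mult_unit)
  moreover have "g \<cdot> (g\<^sup>\<star> \<cdot> g') = g'"
    using cancel_left[OF c1] G by (simp add: star_star)
  ultimately show "g = g'" by simp
  then show "h = h'"
    using cancel_left[OF c(1)] cancel_left[OF c(2)] c(3) by metis
qed

lemma fmult_apply:
  assumes "bisection G (dom a)" "a g = Some x" "b h = Some y" "composable G g h"
  shows "fmult G a b (g \<cdot> h) = Some (x * y)"
proof -
  have "(THE z. \<exists>g'\<in>dom a. \<exists>h'\<in>dom b.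
          composable G g' h' \<and> g \<cdot> h = g' \<cdot> h' \<and> z = the (a g') * the (b h')) = x * y"
  proof (rule the_equality)
    show "\<exists>g'\<in>dom a. \<exists>h'\<in>dom b.
        composable G g' h' \<and> g \<cdot> h = g' \<cdot> h' \<and> x * y = the (a g') * the (b h')"
      using assms by (intro bexI[of _ g] bexI[of _ h]) auto
  next
    fix z
    assume "\<exists>g'\<in>dom a. \<exists>h'\<in>dom b.
        composable G g' h' \<and> g \<cdot> h = g' \<cdot> h' \<and> z = the (a g') * the (b h')"
    then obtain g' h' where *: "g' \<in> dom a" "h' \<in> dom b" "composable G g' h'"
      "g \<cdot> h = g' \<cdot> h'" "z = the (a g') * the (b h')" by blast
    have "g = g'" "h = h'"
      using bisection_factors_unique[OF assms(1) _ *(1) assms(4) *(3,4)] assms(2) by auto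
    then show "z = x * y" using * assms by simp
  qed
  moreover have "g \<cdot> h \<in> set_mult G (dom a) (dom b)"
    using assms by (auto simp: set_mult_def)
  ultimately show ?thesis by (simp add: fmult_def)
qed

end

end

theory Submission imports Defs begin

text \<open>
  The proof rests on one supply of functions: around every arrow \<open>g\<close>, inside every open
  neighbourhood \<open>W\<close> of \<open>g\<close>, some \<open>a \<in> S_at G g\<close> has its whole domain in \<open>W\<close>
  (\<open>S_at_supported_in\<close>).  Continuity of the product and openness of the unit space give \<open>g\<close> an
  open bisection as a neighbourhood.  The source map is injective and continuous on a bisection, with
  values in the Hausdorff unit space, so that bisection is a locally compact Hausdorff space and
  carries a bump function at \<open>g\<close>.  Thus membership in \<open>S_at G g\<close> can test every open neighbourhood
  of \<open>g\<close>, even though \<open>G\<close> itself need not be Hausdorff.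

  Every filter other than \<open>SG G\<close> lies in some \<open>S_at G g\<close>, by compactness
  (\<open>proper_filter_converges\<close>): the sets on which its members have modulus one are compact and
  nonempty, they are directed downwards, and below a fixed member they all lie in the domain of that
  member, which is Hausdorff; so they have a common point \<open>g\<close>.  Since \<open>c \<lesssim> t\<close> puts the open set
  \<open>dom c\<close> inside the set where \<open>t\<close> has modulus one, that point is interior for every \<open>t\<close> of the
  filter.  Conversely each \<open>S_at G g\<close> is a filter other than \<open>SG G\<close>, and an inclusion
  \<open>S_at G g \<subseteq> S_at G h\<close> forces \<open>g = h\<close>, because bump functions at \<open>g\<close> can avoid \<open>h\<close>.  These facts
  together say that the sets \<open>S_at G g\<close> are exactly the ultrafilters and that \<open>g\<close> can be recovered
  from \<open>S_at G g\<close>.  The basic open set of ultrafilters containing \<open>a\<close> pulls back to the interior of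
  the set where \<open>a\<close> has modulus one, and such interiors form a base of the topology of \<open>G\<close>, so the
  bijection is a homeomorphism.

  For inverses, the involution of functions maps \<open>S_at G g\<close> into \<open>S_at G (g\<^sup>\<star>)\<close> and is its own
  inverse.  For products, one inclusion says that \<open>dom b\<close> times \<open>dom c\<close> is an open set containing
  \<open>g \<cdot> h\<close>, because the product is an open map; the other shrinks bump functions at \<open>g\<close> and \<open>h\<close>
  until, by continuity of the product, the product of their domains lies in a given neighbourhood of
  \<open>g \<cdot> h\<close>.
\<close>


section \<open>Bump functions on locally compact Hausdorff spaces\<close>

lemma neighbourhood_base_of_compactin_open_subset:
  assumes base: "neighbourhood_base_of (compactin X) X" and B: "openin X B"
  shows "neighbourhood_base_of (compactin (subtopology X B)) (subtopology X B)"
  unfolding neighbourhood_base_of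
proof (intro allI impI, elim conjE)
  fix W x assume W: "openin (subtopology X B) W" "x \<in> W"
  then have W': "openin X W" "W \<subseteq> B"
    using B by (simp_all add: openin_open_subtopology)
  then obtain U K where "openin X U" "compactin X K" "x \<in> U" "U \<subseteq> K" "K \<subseteq> W"
    using base W(2) unfolding neighbourhood_base_of by metis
  with W'(2) B show "\<exists>U V. openin (subtopology X B) U \<and> compactin (subtopology X B) V \<and>
      x \<in> U \<and> U \<subseteq> V \<and> V \<subseteq> W"
    by (intro exI[of _ U] exI[of _ K]) (auto simp: openin_open_subtopology compactin_subtopology)
qed

text \<open>
  A locally compact Hausdorff space is completely regular, which gives a continuous \<open>h\<close> with
  \<open>h x = 1\<close> that vanishes off a neighbourhood contained in a compact set \<open>K\<close>.  Such an \<open>h\<close> may take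
  the value one at \<open>x\<close> only; truncating \<open>2 * h\<close> at one makes the value one on a whole neighbourhood,
  as membership in \<open>S_at G g\<close> requires.
\<close>

lemma bump_function:
  assumes base: "neighbourhood_base_of (compactin X) X"
    and haus: "Hausdorff_space X"
    and x: "x \<in> topspace X"
  obtains f :: "'a \<Rightarrow> real" and V
  where "continuous_map X euclideanreal f" "f ` topspace X \<subseteq> {0..1}"
    "openin X V" "x \<in> V" "f ` V \<subseteq> {1}"
    "\<forall>e>0. compactin X {y \<in> topspace X. e \<le> f y}"
proof -
  obtain U K where U: "openin X U" "x \<in> U" "U \<subseteq> K" and K: "compactin X K"
    using base x unfolding neighbourhood_base_of by (meson openin_topspace)
  have "completely_regular_space X"
    using base haus locally_compact_regular_imp_completely_regular_space
      locally_compact_space_neighbourhood_base by blast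
  then obtain h where h: "continuous_map X euclideanreal h" "h x = 1"
      "h ` (topspace X - U) \<subseteq> {0}"
    using completely_regular_space_gen_alt'[of "1::real" 0 X] U by (metis zero_neq_one)
  define f where "f y = max 0 (min 1 (2 * h y))" for y
  have cont: "continuous_map X euclideanreal f"
    unfolding f_def by (intro continuous_intros h)
  show thesis
  proof
    show "continuous_map X euclideanreal f" by (rule cont)
    show "f ` topspace X \<subseteq> {0..1}" by (auto simp: f_def)
    show "openin X {y \<in> topspace X. h y \<in> {1/2<..}}"
      using h(1) by (rule openin_continuous_map_preimage) auto
    show "x \<in> {y \<in> topspace X. h y \<in> {1/2<..}}"
      using x h(2) by simp
    show "f ` {y \<in> topspace X. h y \<in> {1/2<..}} \<subseteq> {1}"
      by (auto simp: f_def)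
    show "\<forall>e>0. compactin X {y \<in> topspace X. e \<le> f y}"
    proof (intro allI impI)
      fix e :: real assume "0 < e"
      then have "{y \<in> topspace X. e \<le> f y} \<subseteq> K"
        using h(3) U(3) by (fastforce simp: f_def)
      moreover have "closedin X {y \<in> topspace X. f y \<in> {e..}}"
        using cont by (rule closedin_continuous_map_preimage) auto
      ultimately show "compactin X {y \<in> topspace X. e \<le> f y}"
        using closed_compactin[OF K] by auto
    qed
  qed
qed


section \<open>Open bisections\<close>

lemma bisection_subset: "bisection G A \<Longrightarrow> B \<subseteq> A \<Longrightarrow> bisection G B"
  unfolding bisection_def set_mult_def set_star_def by blast

context groupoid
begin

lemma set_star_eq:
  assumes "A \<subseteq> arrows G"
  shows "set_star G A = {g \<in> arrows G. g\<^sup>\<star> \<in> A}"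
proof (intro equalityI subsetI)
  fix g assume "g \<in> set_star G A"
  then obtain h where "h \<in> A" "g = h\<^sup>\<star>" by (auto simp: set_star_def)
  then show "g \<in> {g \<in> arrows G. g\<^sup>\<star> \<in> A}"
    using assms star_closed star_star by auto
next
  fix g assume "g \<in> {g \<in> arrows G. g\<^sup>\<star> \<in> A}"
  then have "g\<^sup>\<star> \<in> A" "g = (g\<^sup>\<star>)\<^sup>\<star>" using star_star by auto
  then show "g \<in> set_star G A" unfolding set_star_def by blast
qed

lemma set_star_subset: "A \<subseteq> arrows G \<Longrightarrow> set_star G A \<subseteq> arrows G"
  by (auto simp: set_star_eq)

lemma set_star_set_star:
  assumes "A \<subseteq> arrows G"
  shows "set_star G (set_star G A) = A"
  unfolding set_star_eq[OF set_star_subset[OF assms]] unfolding set_star_eq[OF assms]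
  using assms star_closed star_star by auto

lemma bisection_set_star: "bisection G A \<Longrightarrow> bisection G (set_star G A)"
  by (simp add: bisection_def set_star_subset set_star_set_star)

lemma composable_star_left: "g \<in> arrows G \<Longrightarrow> composable G (g\<^sup>\<star>) g"
  by (simp add: composable_iff star_closed star_star)

lemma composable_star_right: "g \<in> arrows G \<Longrightarrow> composable G g (g\<^sup>\<star>)"
  by (simp add: composable_iff star_closed star_star)

text \<open>
  The units \<open>g\<^sup>\<star> \<cdot> g\<close> and \<open>h\<^sup>\<star> \<cdot> h\<close> are products whose first factors lie in the bisection
  \<open>set_star G A\<close>, and a product with first factor in a bisection determines its factors.
\<close>

lemma source_inj_on_bisection:
  assumes "bisection G A"
  shows "inj_on (\<lambda>g. g\<^sup>\<star> \<cdot> g) A"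
proof (rule inj_onI)
  fix g h assume gh: "g \<in> A" "h \<in> A" and eq: "g\<^sup>\<star> \<cdot> g = h\<^sup>\<star> \<cdot> h"
  have arr: "g \<in> arrows G" "h \<in> arrows G"
    using assms gh by (auto simp: bisection_def)
  have "g\<^sup>\<star> \<in> set_star G A" "h\<^sup>\<star> \<in> set_star G A"
    using gh by (auto simp: set_star_def)
  then show "g = h"
    using bisection_factors_unique(2)[OF bisection_set_star[OF assms]]
      composable_star_left arr eq by blast
qed

end

context topological_groupoid
begin

lemma openin_set_star:
  assumes "openin (topol G) A"
  shows "openin (topol G) (set_star G A)"
  using openin_continuous_map_preimage[OF continuous_star assms]
  by (simp add: set_star_eq openin_subset[OF assms])

lemma continuous_source: "continuous_map (topol G) (topol G) (\<lambda>g. g\<^sup>\<star> \<cdot> g)"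
proof -
  have "continuous_map (topol G) (composable_pairs G) (\<lambda>g. (g\<^sup>\<star>, g))"
    unfolding composable_pairs_def
    by (auto simp: continuous_map_in_subtopology continuous_map_pairedI continuous_star
        composable_star_left)
  from continuous_map_compose[OF this continuous_mult] show ?thesis
    by (simp add: o_def)
qed

text \<open>
  Continuity of the partial product at a composable pair, freed from the topology of composable
  pairs.
\<close>

lemma mult_neighbourhoods:
  assumes "composable G g h" and A: "openin (topol G) A" "g \<cdot> h \<in> A"
  obtains V W where "openin (topol G) V" "openin (topol G) W" "g \<in> V" "h \<in> W"
    "set_mult G V W \<subseteq> A"
proof -
  define P where "P = {p \<in> topspace (composable_pairs G). (case p of (g, h) \<Rightarrow> g \<cdot> h) \<in> A}"
  have "openin (composable_pairs G) P"
    unfolding P_def using continuous_mult A(1) by (rule openin_continuous_map_preimage)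
  then have "\<exists>T. openin (prod_topology (topol G) (topol G)) T \<and> P = T \<inter> {(g, h). composable G g h}"
    by (simp add: composable_pairs_def openin_subtopology)
  then obtain T where T: "openin (prod_topology (topol G) (topol G)) T"
      "P = T \<inter> {(g, h). composable G g h}"
    by (elim exE conjE)
  have "(g, h) \<in> P"
    using assms(1) A(2) by (simp add: P_def composable_pairs_def composable_def)
  then have "(g, h) \<in> T" unfolding T(2) by (rule IntD1)
  then obtain V W where VW: "openin (topol G) V" "openin (topol G) W" "g \<in> V" "h \<in> W" "V \<times> W \<subseteq> T"
    using T(1) unfolding openin_prod_topology_alt by metis
  have "set_mult G V W \<subseteq> A"
  proof
    fix k assume "k \<in> set_mult G V W"
    then obtain v w where "v \<in> V" "w \<in> W" "composable G v w" "k = v \<cdot> w"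
      unfolding set_mult_def by blast
    moreover from this have "(v, w) \<in> T \<inter> {(g, h). composable G g h}"
      using VW(5) by auto
    then have "(v, w) \<in> P" by (simp only: T(2))
    ultimately show "k \<in> A" by (simp add: P_def)
  qed
  then show thesis by (rule that[OF VW(1-4)])
qed

text \<open>
  The Hausdorff property is pulled back from the unit space along the source map, which is injective
  on a bisection; distinct arrows with the same source may fail to have disjoint neighbourhoods in
  \<open>G\<close>.
\<close>

lemma bisection_Hausdorff:
  assumes "Hausdorff_space (subtopology (topol G) (units G))" "bisection G A"
  shows "Hausdorff_space (subtopology (topol G) A)"
proof (rule Hausdorff_space_injective_preimage[OF assms(1)])
  have "A \<subseteq> arrows G" using assms(2) by (simp add: bisection_def)
  then show "continuous_map (subtopology (topol G) A) (subtopology (topol G) (units G)) (\<lambda>g. g\<^sup>\<star> \<cdot> g)"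
    using continuous_source
    by (auto simp: continuous_map_in_subtopology continuous_map_from_subtopology units_def)
  show "inj_on (\<lambda>g. g\<^sup>\<star> \<cdot> g) (topspace (subtopology (topol G) A))"
    using source_inj_on_bisection[OF assms(2)] by (rule inj_on_subset) auto
qed

end

context etale_groupoid
begin

lemma openin_set_mult:
  assumes "openin (topol G) V" "openin (topol G) W"
  shows "openin (topol G) (set_mult G V W)"
proof -
  have "openin (composable_pairs G) ((V \<times> W) \<inter> {(g, h). composable G g h})"
    unfolding composable_pairs_def openin_subtopology
    using assms by (intro exI[of _ "V \<times> W"]) (simp add: openin_prod_Times_iff)
  then have "openin (topol G) ((\<lambda>(g, h). g \<cdot> h) ` ((V \<times> W) \<inter> {(g, h). composable G g h}))"
    using open_mult by (simp add: open_map_def)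
  also have "(\<lambda>(g, h). g \<cdot> h) ` ((V \<times> W) \<inter> {(g, h). composable G g h}) = set_mult G V W"
    unfolding set_mult_def by force
  finally show ?thesis .
qed

text \<open>
  Both \<open>g\<^sup>\<star> \<cdot> g\<close> and \<open>g \<cdot> g\<^sup>\<star>\<close> lie in the open set of units, so by continuity the products of arrows
  close to \<open>g\<^sup>\<star>\<close> and \<open>g\<close>, in either order, are units.
\<close>

lemma open_bisection_neighbourhood:
  assumes g: "g \<in> arrows G"
  obtains A where "openin (topol G) A" "g \<in> A" "bisection G A"
proof -
  have u: "g\<^sup>\<star> \<cdot> g \<in> units G" "g \<cdot> g\<^sup>\<star> \<in> units G"
    using g star_closed star_star unfolding units_def by force+
  obtain V1 W1 where 1: "openin (topol G) V1" "openin (topol G) W1" "g\<^sup>\<star> \<in> V1" "g \<in> W1"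
      "set_mult G V1 W1 \<subseteq> units G"
    using mult_neighbourhoods[OF composable_star_left[OF g] open_units u(1)] by blast
  obtain V2 W2 where 2: "openin (topol G) V2" "openin (topol G) W2" "g \<in> V2" "g\<^sup>\<star> \<in> W2"
      "set_mult G V2 W2 \<subseteq> units G"
    using mult_neighbourhoods[OF composable_star_right[OF g] open_units u(2)] by blast
  let ?A = "W1 \<inter> V2 \<inter> set_star G (V1 \<inter> W2)"
  have sub: "V1 \<inter> W2 \<subseteq> arrows G"
    using openin_subset[OF 1(1)] by blast
  show thesis
  proof
    show "openin (topol G) ?A"
      using 1 2 openin_set_star by blast
    show "g \<in> ?A"
      using 1 2 g by (simp add: set_star_eq[OF sub])
    have "set_star G ?A \<subseteq> V1 \<inter> W2"
      unfolding set_star_eq[OF sub] unfolding set_star_def by blast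
    moreover have "?A \<subseteq> arrows G"
      by (auto simp: set_star_eq[OF sub])
    moreover have "set_mult G ?A (V1 \<inter> W2) \<subseteq> set_mult G V2 W2"
        "set_mult G (V1 \<inter> W2) ?A \<subseteq> set_mult G V1 W1"
      unfolding set_mult_def by blast+
    ultimately show "bisection G ?A"
      using 1(5) 2(5) unfolding bisection_def set_mult_def by blast
  qed
qed

end


section \<open>The relation \<open>\<lesssim>\<close>, its filters, and the sets \<open>S_at G g\<close>\<close>

lemma SG_D:
  assumes "a \<in> SG G"
  shows "openin (topol G) (dom a)" "bisection G (dom a)"
    "compactin (topol G) (preimage a (sphere 0 1))"
proof -
  show "openin (topol G) (dom a)" "bisection G (dom a)"
    using assms by (auto simp: SG_def)
  have "cmod z \<le> 1" if "a g = Some z" for g z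
  proof -
    have "ran a \<subseteq> cball 0 1 - {0}" "z \<in> ran a"
      using assms that by (simp_all add: SG_def ranI)
    then have "z \<in> cball 0 1" by auto
    then show ?thesis by simp
  qed
  then have "preimage a (sphere 0 1) = {g \<in> dom a. 1 \<le> cmod (the (a g))}"
    unfolding preimage_def dom_def by (auto intro!: order_antisym)
  then show "compactin (topol G) (preimage a (sphere 0 1))"
    using assms by (simp add: SG_def)
qed

lemma preimage_subset_dom: "preimage a C \<subseteq> dom a"
  by (auto simp: preimage_def)

lemma dominated_trans: "a \<lesssim> b \<Longrightarrow> b \<lesssim> c \<Longrightarrow> a \<lesssim> c"
  unfolding dominated_def by (rule subset_trans[OF _ subset_trans[OF preimage_subset_dom]])

lemma empty_in_SG: "Map.empty \<in> SG G"
  by (auto simp: SG_def bisection_def set_mult_def set_star_def)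

lemma filter_subset_SG: "is_filter G T \<Longrightarrow> T \<subseteq> SG G"
  by (simp add: is_filter_def)

lemma filter_iff:
  "is_filter G T \<Longrightarrow> a \<in> SG G \<Longrightarrow> b \<in> SG G \<Longrightarrow>
    a \<in> T \<and> b \<in> T \<longleftrightarrow> (\<exists>c\<in>T. c \<lesssim> a \<and> c \<lesssim> b)"
  by (simp add: is_filter_def)

lemma filter_upward: "is_filter G T \<Longrightarrow> c \<in> T \<Longrightarrow> a \<in> SG G \<Longrightarrow> c \<lesssim> a \<Longrightarrow> a \<in> T"
  using filter_iff[of G T a a] by auto

lemma filter_lower_bound:
  assumes "is_filter G T" "a \<in> T" "b \<in> T"
  obtains c where "c \<in> T" "c \<lesssim> a" "c \<lesssim> b"
proof -
  have "a \<in> SG G" "b \<in> SG G" using assms filter_subset_SG by auto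
  from filter_iff[OF assms(1) this] show thesis using assms(2,3) that by auto
qed

text \<open>
  The empty function is below everything, so it plays the part of the zero element.
\<close>

lemma empty_not_in_proper_filter:
  assumes T: "is_filter G T" "T \<noteq> SG G"
  shows "Map.empty \<notin> T"
proof
  assume "Map.empty \<in> T"
  then have "SG G \<subseteq> T"
    using filter_upward[OF T(1)] by (auto simp: dominated_def)
  then show False using T filter_subset_SG by auto
qed

lemma filter_finite_lower_bound:
  assumes T: "is_filter G T" and "finite F" "F \<noteq> {}" "F \<subseteq> T"
  shows "\<exists>c\<in>T. \<forall>a\<in>F. c \<lesssim> a"
  using assms(2-4)
proof (induction rule: finite_ne_induct)
  case (singleton a)
  then show ?case using filter_lower_bound[OF T, of a a] by auto
next
  case (insert a F)
  then obtain c where c: "c \<in> T" "\<forall>a\<in>F. c \<lesssim> a" by auto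
  obtain d where "d \<in> T" "d \<lesssim> c" "d \<lesssim> a"
    using filter_lower_bound[OF T c(1)] insert.prems by blast
  then show ?case using c dominated_trans by blast
qed

lemma S_at_imp_SG: "a \<in> S_at G g \<Longrightarrow> a \<in> SG G"
  by (simp add: S_at_def)

lemma S_at_imp_mem_dom: "a \<in> S_at G g \<Longrightarrow> g \<in> dom a"
  unfolding S_at_def using interior_of_subset preimage_subset_dom by fast

lemma S_at_if_open_subset:
  assumes "a \<in> SG G" "openin (topol G) V" "g \<in> V" "V \<subseteq> preimage a (sphere 0 1)"
  shows "a \<in> S_at G g"
  using assms by (auto simp: S_at_def interior_of_def)

text \<open>
  The way in which interiors enter without being computed: \<open>dom c\<close> is an open set on which every
  function dominating \<open>c\<close> has modulus one.
\<close>

lemma S_at_if_dominates: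
  assumes "a \<in> SG G" "c \<in> SG G" "c \<lesssim> a" "g \<in> dom c"
  shows "a \<in> S_at G g"
  using S_at_if_open_subset[OF assms(1) SG_D(1)[OF assms(2)] assms(4)] assms(3)
  by (simp add: dominated_def)

locale locally_compact_etale_groupoid = etale_groupoid +
  assumes locally_compact: "neighbourhood_base_of (compactin (topol G)) (topol G)"
    and Hausdorff_units: "Hausdorff_space (subtopology (topol G) (units G))"
begin

lemma Hausdorff_dom: "a \<in> SG G \<Longrightarrow> Hausdorff_space (subtopology (topol G) (dom a))"
  using bisection_Hausdorff[OF Hausdorff_units] SG_D by blast

lemma closedin_dom:
  assumes "a \<in> SG G" "compactin (topol G) K" "K \<subseteq> dom a"
  shows "closedin (subtopology (topol G) (dom a)) K"
  using assms compactin_imp_closedin[OF Hausdorff_dom] by (simp add: compactin_subtopology)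

text \<open>
  A compact subset of \<open>dom a\<close> is closed in \<open>dom a\<close> but perhaps not in \<open>G\<close>; removing it from the open
  set \<open>dom a\<close> still leaves an open subset of \<open>G\<close>.
\<close>

lemma openin_dom_diff:
  assumes "a \<in> SG G" "compactin (topol G) K" "K \<subseteq> dom a"
  shows "openin (topol G) (dom a - K)"
proof -
  have "openin (subtopology (topol G) (dom a)) (topspace (subtopology (topol G) (dom a)) - K)"
    using closedin_dom[OF assms] by blast
  then have "openin (topol G) (topspace (subtopology (topol G) (dom a)) - K)"
    using SG_D(1)[OF assms(1)] openin_trans_full by blast
  then show ?thesis
    using openin_subset[OF SG_D(1)[OF assms(1)]] by (simp add: inf_absorb2)
qed

text \<open>
  The bump function of an open bisection inside \<open>W\<close>, restricted to where it is positive, since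
  elements of \<open>SG G\<close> do not take the value zero.
\<close>

lemma S_at_supported_in:
  assumes W: "openin (topol G) W" "g \<in> W"
  obtains a where "a \<in> S_at G g" "dom a \<subseteq> W"
proof -
  have "g \<in> arrows G" using W openin_subset by blast
  then obtain A where A: "openin (topol G) A" "g \<in> A" "bisection G A"
    by (rule open_bisection_neighbourhood)
  define B where "B = W \<inter> A"
  have B: "openin (topol G) B" "g \<in> B" "bisection G B" "B \<subseteq> W"
    using W A bisection_subset[OF A(3)] by (auto simp: B_def)
  let ?Y = "subtopology (topol G) B"
  have topY: "topspace ?Y = B"
    using openin_subset[OF B(1)] by auto
  have "neighbourhood_base_of (compactin ?Y) ?Y"
    using locally_compact B(1) by (rule neighbourhood_base_of_compactin_open_subset)
  moreover have "Hausdorff_space ?Y"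
    using Hausdorff_units B(3) by (rule bisection_Hausdorff)
  moreover have "g \<in> topspace ?Y"
    using B(2) by (simp only: topY)
  ultimately obtain f V where "continuous_map ?Y euclideanreal f" "f ` topspace ?Y \<subseteq> {0..1}"
      "openin ?Y V" "g \<in> V" "f ` V \<subseteq> {1}"
      "\<forall>e>0. compactin ?Y {y \<in> topspace ?Y. e \<le> f y}"
    by (rule bump_function)
  note f = this[unfolded topY]
  define a where "a y = (if y \<in> B \<and> 0 < f y then Some (complex_of_real (f y)) else None)" for y
  have dom_a: "dom a = {y \<in> B. 0 < f y}"
    by (auto simp: a_def dom_def)
  have V: "openin (topol G) V" "V \<subseteq> B"
    using f(3) B(1) openin_open_subtopology by blast+
  have "a \<in> SG G"
    unfolding SG_def
  proof (intro CollectI conjI allI impI)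
    have "openin ?Y {y \<in> topspace ?Y. f y \<in> {0<..}}"
      using f(1) by (rule openin_continuous_map_preimage) auto
    then show "openin (topol G) (dom a)"
      using B(1) by (simp add: openin_open_subtopology dom_a topY del: topspace_subtopology)
    show "bisection G (dom a)"
      using B(3) by (rule bisection_subset) (auto simp: dom_a)
    show "ran a \<subseteq> cball 0 1 - {0}"
      using f(2) by (auto simp: a_def ran_def split: if_splits)
    have "continuous_map (subtopology (topol G) (dom a)) euclidean (\<lambda>y. complex_of_real (f y))"
    proof (rule continuous_map_from_subtopology_mono)
      have "continuous_map euclideanreal euclidean complex_of_real"
        by (simp add: continuous_on_of_real)
      from continuous_map_compose[OF f(1) this]
      show "continuous_map ?Y euclidean (\<lambda>y. complex_of_real (f y))"
        by (simp only: o_def)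
    qed (auto simp: dom_a)
    then show "continuous_map (subtopology (topol G) (dom a)) euclidean (\<lambda>y. the (a y))"
      by (rule continuous_map_eq) (auto simp: dom_a a_def)
    fix e :: real assume e: "0 < e"
    have "{y \<in> dom a. e \<le> cmod (the (a y))} = {y \<in> B. e \<le> f y}"
      using e by (auto simp: dom_a a_def)
    then show "compactin (topol G) {y \<in> dom a. e \<le> cmod (the (a y))}"
      using f(6) e by (simp add: compactin_subtopology)
  qed
  moreover have "V \<subseteq> preimage a (sphere 0 1)"
    using f(5) V(2) by (fastforce simp: preimage_def a_def)
  ultimately have "a \<in> S_at G g"
    by (intro S_at_if_open_subset[OF _ V(1) f(4)])
  moreover have "dom a \<subseteq> W" using B(4) by (auto simp: dom_a)
  ultimately show thesis by (rule that)
qed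


lemma S_at_nonempty: "g \<in> arrows G \<Longrightarrow> \<exists>a. a \<in> S_at G g"
  by (rule S_at_supported_in[OF openin_topspace]) auto


section \<open>Arrows correspond to ultrafilters\<close>

lemma S_at_proper_filter:
  assumes g: "g \<in> arrows G"
  shows "is_filter G (S_at G g)" "S_at G g \<noteq> SG G"
proof -
  have low: "\<exists>c\<in>S_at G g. c \<lesssim> a \<and> c \<lesssim> b" if "a \<in> S_at G g" "b \<in> S_at G g" for a b
  proof -
    let ?W = "topol G interior_of preimage a (sphere 0 1) \<inter> topol G interior_of preimage b (sphere 0 1)"
    have "openin (topol G) ?W" "g \<in> ?W"
      using that by (auto simp: S_at_def)
    then obtain c where c: "c \<in> S_at G g" "dom c \<subseteq> ?W"
      by (rule S_at_supported_in)
    from c(2) have "c \<lesssim> a" "c \<lesssim> b"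
      unfolding dominated_def
      using interior_of_subset[of "topol G" "preimage a (sphere 0 1)"]
        interior_of_subset[of "topol G" "preimage b (sphere 0 1)"] by auto
    with c(1) show ?thesis by (intro bexI[of _ c] conjI)
  qed
  have up: "a \<in> S_at G g" if "a \<in> SG G" "c \<in> S_at G g" "c \<lesssim> a" for a c
    by (rule S_at_if_dominates[OF that(1) S_at_imp_SG[OF that(2)] that(3) S_at_imp_mem_dom[OF that(2)]])
  show "is_filter G (S_at G g)"
    unfolding is_filter_def
  proof (intro conjI ballI iffI)
    show "S_at G g \<noteq> {}" using S_at_nonempty[OF g] by auto
    show "S_at G g \<subseteq> SG G" by (auto simp: S_at_def)
  next
    fix a b assume "a \<in> S_at G g \<and> b \<in> S_at G g"
    then show "\<exists>c\<in>S_at G g. c \<lesssim> a \<and> c \<lesssim> b" using low by simp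
  next
    fix a b assume "a \<in> SG G" "\<exists>c\<in>S_at G g. c \<lesssim> a \<and> c \<lesssim> b"
    then show "a \<in> S_at G g" by (elim bexE conjE) (rule up)
  next
    fix a b assume "b \<in> SG G" "\<exists>c\<in>S_at G g. c \<lesssim> a \<and> c \<lesssim> b"
    then show "b \<in> S_at G g" by (elim bexE conjE) (rule up)
  qed
  show "S_at G g \<noteq> SG G"
    using S_at_imp_mem_dom[of Map.empty G g] empty_in_SG by auto
qed

text \<open>
  Membership of one \<open>a\<close> in both sets places \<open>g\<close> and \<open>h\<close> in the same open bisection \<open>dom a\<close>, in which
  points are closed; a bump function at \<open>g\<close> can then be supported away from \<open>h\<close>.  This gives the
  injectivity of \<open>S_at G\<close> and, together with the fact that every filter other than \<open>SG G\<close> lies in some \<open>S_at G h\<close>, the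
  maximality of \<open>S_at G g\<close>.
\<close>

lemma S_at_subset_imp_eq:
  assumes g: "g \<in> arrows G" and sub: "S_at G g \<subseteq> S_at G h"
  shows "g = h"
proof (rule ccontr)
  assume "g \<noteq> h"
  obtain a where a: "a \<in> S_at G g" using S_at_nonempty[OF g] by auto
  then have dom: "g \<in> dom a" "h \<in> dom a"
    using sub S_at_imp_mem_dom[of a G] by auto
  then have "h \<in> arrows G" using openin_subset[OF SG_D(1)[OF S_at_imp_SG[OF a]]] by auto
  then have "openin (topol G) (dom a - {h})" "g \<in> dom a - {h}"
    using openin_dom_diff[OF S_at_imp_SG[OF a], of "{h}"] dom \<open>g \<noteq> h\<close> by auto
  then obtain c where "c \<in> S_at G g" "dom c \<subseteq> dom a - {h}"
    by (rule S_at_supported_in)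
  then show False using sub S_at_imp_mem_dom[of c G h] by auto
qed

text \<open>
  Compactness: the arrow is a common point of the sets where the members of the filter below a fixed
  member \<open>u\<close> have modulus one.  Working below \<open>u\<close> keeps these compact sets inside the Hausdorff space
  \<open>dom u\<close>, where they are closed.
\<close>

lemma proper_filter_converges:
  assumes T: "is_filter G T" "T \<noteq> SG G"
  obtains g where "g \<in> arrows G" "T \<subseteq> S_at G g"
proof -
  have TS: "a \<in> SG G" if "a \<in> T" for a using filter_subset_SG[OF T(1)] that by auto
  have dom_ne: "dom c \<noteq> {}" if "c \<in> T" for c
    using empty_not_in_proper_filter[OF T] that by auto
  obtain u where u: "u \<in> T" using T(1) by (auto simp: is_filter_def)
  let ?K = "\<lambda>a. preimage a (sphere 0 1)"
  let ?C = "?K ` {a \<in> T. a \<lesssim> u}"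
  let ?Y = "subtopology (topol G) (dom u)"
  have compact: "compactin ?Y (?K u)"
    using SG_D(3)[OF TS[OF u]] by (simp add: compactin_subtopology preimage_subset_dom)
  have closed: "closedin ?Y C" if C: "C \<in> ?C" for C
  proof -
    obtain a where a: "a \<in> T" "a \<lesssim> u" "C = ?K a" using C by auto
    have "dom a \<subseteq> dom u"
      using a(2) preimage_subset_dom unfolding dominated_def by (rule subset_trans)
    then have "?K a \<subseteq> dom u" using preimage_subset_dom by (rule subset_trans[rotated])
    with TS[OF u] SG_D(3)[OF TS[OF a(1)]] show ?thesis
      unfolding a(3) by (rule closedin_dom)
  qed
  \<comment> \<open>a lower bound \<open>c\<close> of finitely many members has its nonempty domain in all the corresponding sets\<close>
  have "?K u \<inter> \<Inter>\<F> \<noteq> {}" if \<F>: "finite \<F>" "\<F> \<subseteq> ?C" for \<F>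
  proof -
    obtain F where F: "F \<subseteq> {a \<in> T. a \<lesssim> u}" "finite F" "\<F> = ?K ` F"
      using finite_subset_image[OF \<F>] by metis
    have "finite (insert u F)" "insert u F \<noteq> {}" "insert u F \<subseteq> T"
      using F u by auto
    from filter_finite_lower_bound[OF T(1) this]
    obtain c where c: "c \<in> T" "\<forall>a\<in>insert u F. c \<lesssim> a" by metis
    then have "dom c \<subseteq> ?K u \<inter> \<Inter>\<F>"
      unfolding F(3) dominated_def by auto
    then show ?thesis using dom_ne[OF c(1)] by blast
  qed
  with compact closed have "?K u \<inter> \<Inter>?C \<noteq> {}"
    unfolding compactin_fip by simp
  then obtain g where g: "g \<in> ?K u" "\<And>a. a \<in> T \<Longrightarrow> a \<lesssim> u \<Longrightarrow> g \<in> ?K a" by auto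
  \<comment> \<open>passing to some \<open>c \<lesssim> t\<close> turns membership of \<open>g\<close> in these compact sets into interiority\<close>
  have "t \<in> S_at G g" if t: "t \<in> T" for t
  proof -
    obtain c where c: "c \<in> T" "c \<lesssim> t" "c \<lesssim> u"
      using T(1) t u by (rule filter_lower_bound)
    then have "g \<in> dom c" using g(2) preimage_subset_dom by (metis subsetD)
    with TS[OF t] TS[OF c(1)] c(2) show ?thesis by (rule S_at_if_dominates)
  qed
  moreover have "g \<in> arrows G"
    using g(1) compactin_subset_topspace[OF SG_D(3)[OF TS[OF u]]] by auto
  ultimately show thesis using that by auto
qed

lemma S_at_ultrafilter:
  assumes g: "g \<in> arrows G"
  shows "S_at G g \<in> ultrafilters G"
  unfolding ultrafilters_def
proof (intro CollectI conjI allI impI; (elim conjE)?)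
  show "is_filter G (S_at G g)" "S_at G g \<noteq> SG G"
    using S_at_proper_filter[OF g] by simp_all
  fix T assume T: "is_filter G T" "T \<noteq> SG G" "S_at G g \<subseteq> T"
  obtain h where h: "h \<in> arrows G" "T \<subseteq> S_at G h"
    using T(1,2) by (rule proper_filter_converges)
  then have "g = h" using S_at_subset_imp_eq[OF g] T(3) by auto
  then show "T = S_at G g" using h(2) T(3) by simp
qed

lemma ultrafilter_eq_S_at:
  assumes "U \<in> ultrafilters G"
  shows "\<exists>g\<in>arrows G. U = S_at G g"
proof -
  have U: "is_filter G U" "U \<noteq> SG G"
    "\<And>T. is_filter G T \<Longrightarrow> T \<noteq> SG G \<Longrightarrow> U \<subseteq> T \<Longrightarrow> T = U"
    using assms by (simp_all add: ultrafilters_def)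
  obtain g where g: "g \<in> arrows G" "U \<subseteq> S_at G g"
    using U(1,2) by (rule proper_filter_converges)
  have "S_at G g = U"
    using S_at_proper_filter[OF g(1)] g(2) by (rule U(3))
  with g(1) show ?thesis by (intro bexI[of _ g]) simp_all
qed

text \<open>
  Continuity holds because the basic open set given by \<open>a\<close> pulls back to the interior in the
  definition of \<open>S_at\<close>.  Openness: if \<open>c \<in> S_at G g\<close> has its domain in \<open>V\<close>, every ultrafilter
  containing \<open>c\<close> is \<open>S_at G h\<close> for some \<open>h \<in> dom c\<close>, hence for some \<open>h \<in> V\<close>.
\<close>

lemma S_at_homeomorphic_map: "homeomorphic_map (topol G) (ultrafilter_space G) (S_at G)"
proof (rule bijective_open_imp_homeomorphic_map)
  show "S_at G ` arrows G = topspace (ultrafilter_space G)"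
    unfolding topspace_ultrafilter_space
  proof (intro equalityI image_subsetI subsetI)
    fix U assume "U \<in> ultrafilters G"
    then have "\<exists>g\<in>arrows G. U = S_at G g" by (rule ultrafilter_eq_S_at)
    then show "U \<in> S_at G ` arrows G" by (simp add: image_iff)
  qed (rule S_at_ultrafilter)
  show "inj_on (S_at G) (arrows G)" by (rule inj_onI) (simp add: S_at_subset_imp_eq)
  show "continuous_map (topol G) (ultrafilter_space G) (S_at G)"
    unfolding ultrafilter_space_def
  proof (rule continuous_on_generated_topo)
    fix B assume "B \<in> {{U \<in> ultrafilters G. a \<in> U} |a. a \<in> SG G}"
    then obtain a where a: "a \<in> SG G" "B = {U \<in> ultrafilters G. a \<in> U}" by auto
    have "g \<in> S_at G -` B \<inter> arrows G \<longleftrightarrow> g \<in> topol G interior_of preimage a (sphere 0 1)" for g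
      using S_at_ultrafilter[of g] a
        subsetD[OF interior_of_subset_topspace[of "topol G" "preimage a (sphere 0 1)"], of g]
      by (simp add: S_at_def) blast
    then have "S_at G -` B \<inter> arrows G = topol G interior_of preimage a (sphere 0 1)"
      by (rule set_eqI)
    then show "openin (topol G) (S_at G -` B \<inter> arrows G)" by simp
  next
    show "S_at G ` arrows G \<subseteq> \<Union> {{U \<in> ultrafilters G. a \<in> U} |a. a \<in> SG G}"
    proof (rule image_subsetI)
      fix g assume g: "g \<in> arrows G"
      obtain a where a: "a \<in> S_at G g" using S_at_nonempty[OF g] by auto
      have "{U \<in> ultrafilters G. a \<in> U} \<in> {{U \<in> ultrafilters G. a \<in> U} |a. a \<in> SG G}"
        using S_at_imp_SG[OF a] by auto
      then show "S_at G g \<in> \<Union> {{U \<in> ultrafilters G. a \<in> U} |a. a \<in> SG G}"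
        by (rule UnionI) (simp add: S_at_ultrafilter[OF g] a)
    qed
  qed
  show "open_map (topol G) (ultrafilter_space G) (S_at G)"
    unfolding open_map_def
  proof (intro allI impI)
    fix V assume V: "openin (topol G) V"
    show "openin (ultrafilter_space G) (S_at G ` V)"
    proof (rule openin_subopen[THEN iffD2], rule ballI)
      fix T assume "T \<in> S_at G ` V"
      then obtain g where g: "g \<in> V" "T = S_at G g" by auto
      from g(1) obtain c where c: "c \<in> S_at G g" "dom c \<subseteq> V"
        by (rule S_at_supported_in[OF V])
      let ?B = "{U \<in> ultrafilters G. c \<in> U}"
      have "openin (ultrafilter_space G) ?B"
        unfolding ultrafilter_space_def
        using S_at_imp_SG[OF c(1)] by (intro topology_generated_by_Basis) auto
      moreover have "S_at G g \<in> ?B"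
        using c(1) openin_subset[OF V] g(1) S_at_ultrafilter by auto
      moreover have "?B \<subseteq> S_at G ` V"
      proof
        fix U assume "U \<in> ?B"
        then have U: "U \<in> ultrafilters G" "c \<in> U" by simp_all
        then obtain h where h: "U = S_at G h" using ultrafilter_eq_S_at by auto
        then have "h \<in> V" using U(2) c(2) S_at_imp_mem_dom[of c G h] by auto
        then show "U \<in> S_at G ` V" unfolding h by (rule imageI)
      qed
      ultimately show "\<exists>B. openin (ultrafilter_space G) B \<and> T \<in> B \<and> B \<subseteq> S_at G ` V"
        unfolding g(2) by (intro exI[of _ ?B] conjI)
    qed
  qed
qed

end


section \<open>Inverses and products\<close>

context topological_groupoid
begin

lemma fstar_in_SG:
  assumes a: "a \<in> SG G"
  shows "fstar G a \<in> SG G"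
proof -
  note op = SG_D(1)[OF a]
  note dom_eq = set_star_eq[OF openin_subset[OF op]]
  have dom_f: "dom (fstar G a) = {g \<in> arrows G. g\<^sup>\<star> \<in> dom a}"
    by (simp add: dom_fstar dom_eq)
  have val: "fstar G a g = Some (cnj (the (a (g\<^sup>\<star>))))" if "g \<in> dom (fstar G a)" for g
    using that unfolding dom_fstar by (simp add: fstar_def)
  show ?thesis
    unfolding SG_def
  proof (intro CollectI conjI allI impI)
    show "openin (topol G) (dom (fstar G a))" "bisection G (dom (fstar G a))"
      unfolding dom_fstar
      by (rule openin_set_star[OF op], rule bisection_set_star[OF SG_D(2)[OF a]])
    show "ran (fstar G a) \<subseteq> cball 0 1 - {0}"
    proof
      fix z assume "z \<in> ran (fstar G a)"
      then obtain g where g: "fstar G a g = Some z" by (auto simp: ran_def)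
      then have d: "g \<in> dom (fstar G a)" by blast
      then obtain w where w: "a (g\<^sup>\<star>) = Some w" using dom_f by auto
      then have "w \<in> cball 0 1 - {0}" using a by (auto simp: SG_def ran_def)
      moreover have "z = cnj w" using val[OF d] g w by simp
      ultimately show "z \<in> cball 0 1 - {0}" by simp
    qed
    have "continuous_map (subtopology (topol G) (dom (fstar G a))) (subtopology (topol G) (dom a)) (\<lambda>g. g\<^sup>\<star>)"
      using continuous_star
      by (auto simp: continuous_map_in_subtopology continuous_map_from_subtopology dom_f)
    moreover have "continuous_map (subtopology (topol G) (dom a)) euclidean (\<lambda>g. the (a g))"
      using a by (simp add: SG_def)
    moreover have "continuous_map euclidean euclidean cnj"
      by (simp add: continuous_on_cnj)
    ultimately have "continuous_map (subtopology (topol G) (dom (fstar G a))) euclidean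
        (cnj \<circ> ((\<lambda>g. the (a g)) \<circ> (\<lambda>g. g\<^sup>\<star>)))"
      by (intro continuous_map_compose)
    then have "continuous_map (subtopology (topol G) (dom (fstar G a))) euclidean (\<lambda>g. cnj (the (a (g\<^sup>\<star>))))"
      by (simp only: o_def)
    then show "continuous_map (subtopology (topol G) (dom (fstar G a))) euclidean (\<lambda>g. the (fstar G a g))"
      by (rule continuous_map_eq) (simp add: val)
    fix e :: real assume "0 < e"
    then have "compactin (topol G) {g \<in> dom a. e \<le> cmod (the (a g))}"
      using a by (simp add: SG_def)
    then have "compactin (topol G) ((\<lambda>g. g\<^sup>\<star>) ` {g \<in> dom a. e \<le> cmod (the (a g))})"
      using continuous_star by (rule image_compactin)
    also have "(\<lambda>g. g\<^sup>\<star>) ` {g \<in> dom a. e \<le> cmod (the (a g))} = set_star G {g \<in> dom a. e \<le> cmod (the (a g))}"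
      by (auto simp: set_star_def)
    also have "\<dots> = {g \<in> dom (fstar G a). e \<le> cmod (the (fstar G a g))}"
    proof -
      have "cmod (the (fstar G a g)) = cmod z" if "g \<in> arrows G" "a (g\<^sup>\<star>) = Some z" for g z
        using val[of g] that by (simp add: dom_f domI)
      then show ?thesis
        using openin_subset[OF op] by (subst set_star_eq) (auto simp: dom_f)
    qed
    finally show "compactin (topol G) {g \<in> dom (fstar G a). e \<le> cmod (the (fstar G a g))}" .
  qed
qed

lemma fstar_fstar:
  assumes a: "a \<in> SG G"
  shows "fstar G (fstar G a) = a"
proof
  fix g
  have sub: "dom a \<subseteq> arrows G" by (rule openin_subset[OF SG_D(1)[OF a]])
  show "fstar G (fstar G a) g = a g"
  proof (cases "g \<in> dom a")
    case True
    then have "g \<in> arrows G" "g\<^sup>\<star> \<in> set_star G (dom a)"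
      using sub by (auto simp: set_star_def)
    then show ?thesis
      using True sub by (auto simp: fstar_def dom_fstar[unfolded fstar_def] set_star_set_star star_star)
  next
    case False
    then have "g \<notin> dom (fstar G (fstar G a))"
      unfolding dom_fstar set_star_set_star[OF sub] .
    then show ?thesis using False by (metis domIff)
  qed
qed

lemma fstar_in_S_at:
  assumes "a \<in> S_at G g"
  shows "fstar G a \<in> S_at G (g\<^sup>\<star>)"
proof -
  let ?V = "topol G interior_of preimage a (sphere 0 1)"
  have a: "a \<in> SG G" and g: "g \<in> ?V" using assms by (auto simp: S_at_def)
  have V: "?V \<subseteq> arrows G" by (rule interior_of_subset_topspace)
  show ?thesis
  proof (rule S_at_if_open_subset[OF fstar_in_SG[OF a]])
    show "openin (topol G) (set_star G ?V)" by (rule openin_set_star) simp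
    show "g\<^sup>\<star> \<in> set_star G ?V" using g by (auto simp: set_star_def)
    show "set_star G ?V \<subseteq> preimage (fstar G a) (sphere 0 1)"
    proof
      fix k assume "k \<in> set_star G ?V"
      then obtain h where h: "h \<in> ?V" "k = h\<^sup>\<star>" by (auto simp: set_star_def)
      then obtain z where z: "a h = Some z" "z \<in> sphere 0 1"
        using interior_of_subset[of "topol G" "preimage a (sphere 0 1)"]
        unfolding preimage_def by auto
      have "k\<^sup>\<star> = h" using h V star_star by auto
      moreover have "k \<in> set_star G (dom a)" using h z by (auto simp: set_star_def)
      ultimately show "k \<in> preimage (fstar G a) (sphere 0 1)"
        using z by (simp add: preimage_def fstar_def)
    qed
  qed
qed

text \<open>
  The involution maps \<open>S_at G g\<close> into \<open>S_at G (g\<^sup>\<star>)\<close>; as it is its own inverse, the same fact at \<open>g\<^sup>\<star>\<close>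
  gives the reverse inclusion.
\<close>

lemma S_at_star:
  assumes g: "g \<in> arrows G"
  shows "S_at G (g\<^sup>\<star>) = Fstar G (S_at G g)"
proof
  show "Fstar G (S_at G g) \<subseteq> S_at G (g\<^sup>\<star>)"
    using fstar_in_S_at by (auto simp: Fstar_def)
  show "S_at G (g\<^sup>\<star>) \<subseteq> Fstar G (S_at G g)"
  proof
    fix a assume a: "a \<in> S_at G (g\<^sup>\<star>)"
    then have "fstar G a \<in> S_at G g"
      using fstar_in_S_at[of a "g\<^sup>\<star>"] star_star[OF g] by simp
    moreover have "a = fstar G (fstar G a)"
      using fstar_fstar[OF S_at_imp_SG[OF a]] by simp
    ultimately show "a \<in> Fstar G (S_at G g)" unfolding Fstar_def by auto
  qed
qed

end

lemma up_closure_Fmult: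
  "up_closure G (Fmult G T U) = {a \<in> SG G. \<exists>b\<in>T. \<exists>c\<in>U. fmult G b c \<lesssim> a}"
  by (auto simp: up_closure_def Fmult_def)

text \<open>
  The relation \<open>fmult G b c \<lesssim> a\<close> depends on \<open>fmult G b c\<close> through its domain
  \<open>set_mult G (dom b) (dom c)\<close> alone, so this is a statement about products of open sets: one
  inclusion is continuity of the product, the other its openness.
\<close>

lemma (in locally_compact_etale_groupoid) S_at_mult:
  assumes gh: "composable G g h"
  shows "S_at G (g \<cdot> h) = up_closure G (Fmult G (S_at G g) (S_at G h))"
  unfolding up_closure_Fmult
proof (intro equalityI subsetI)
  fix a assume a: "a \<in> S_at G (g \<cdot> h)"
  let ?O = "topol G interior_of preimage a (sphere 0 1)"
  have "openin (topol G) ?O" "g \<cdot> h \<in> ?O" using a by (auto simp: S_at_def)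
  from mult_neighbourhoods[OF gh this] obtain V W where VW: "openin (topol G) V" "openin (topol G) W"
      "g \<in> V" "h \<in> W" "set_mult G V W \<subseteq> ?O" .
  obtain b where b: "b \<in> S_at G g" "dom b \<subseteq> V"
    using VW(1,3) by (rule S_at_supported_in)
  obtain c where c: "c \<in> S_at G h" "dom c \<subseteq> W"
    using VW(2,4) by (rule S_at_supported_in)
  have "dom (fmult G b c) \<subseteq> set_mult G V W"
    unfolding dom_fmult set_mult_def using b c by blast
  also have "\<dots> \<subseteq> preimage a (sphere 0 1)"
    using VW(5) interior_of_subset by (rule subset_trans)
  finally have "fmult G b c \<lesssim> a" by (simp add: dominated_def)
  then show "a \<in> {a \<in> SG G. \<exists>b\<in>S_at G g. \<exists>c\<in>S_at G h. fmult G b c \<lesssim> a}"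
    using b(1) c(1) S_at_imp_SG[OF a] by auto
next
  fix a assume "a \<in> {a \<in> SG G. \<exists>b\<in>S_at G g. \<exists>c\<in>S_at G h. fmult G b c \<lesssim> a}"
  then obtain b c where a: "a \<in> SG G" and b: "b \<in> S_at G g" and c: "c \<in> S_at G h"
    and le: "fmult G b c \<lesssim> a" by auto
  show "a \<in> S_at G (g \<cdot> h)"
  proof (rule S_at_if_open_subset[OF a])
    show "openin (topol G) (set_mult G (dom b) (dom c))"
      using S_at_imp_SG[OF b] S_at_imp_SG[OF c] by (intro openin_set_mult SG_D(1))
    show "g \<cdot> h \<in> set_mult G (dom b) (dom c)"
      using S_at_imp_mem_dom[OF b] S_at_imp_mem_dom[OF c] gh unfolding set_mult_def by blast
    show "set_mult G (dom b) (dom c) \<subseteq> preimage a (sphere 0 1)"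
      using le by (simp add: dominated_def dom_fmult)
  qed
qed

theorem proposition1p2:
  fixes G :: "'g top_groupoid" (structure)
  assumes "etale_groupoid G"
    and "neighbourhood_base_of (compactin (topol G)) (topol G)"
    and "Hausdorff_space (subtopology (topol G) (units G))"
  shows "homeomorphic_map (topol G) (ultrafilter_space G) (S_at G) \<and>
    (\<forall>g h. composable G g h \<longrightarrow>
       S_at G (g\<^sup>\<star>) = Fstar G (S_at G g) \<and>
       S_at G (g \<cdot> h) = up_closure G (Fmult G (S_at G g) (S_at G h)) \<and>
       up_closure G (Fmult G (S_at G g) (S_at G h)) =
         {a \<in> SG G. \<exists>b\<in>S_at G g. \<exists>c\<in>S_at G h. fmult G b c \<lesssim> a})"
proof -
  interpret locally_compact_etale_groupoid G
    using assms
    by (simp add: locally_compact_etale_groupoid_def locally_compact_etale_groupoid_axioms_def)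
  show ?thesis
  proof (intro conjI allI impI)
    show "homeomorphic_map (topol G) (ultrafilter_space G) (S_at G)"
      by (rule S_at_homeomorphic_map)
    fix g h assume gh: "composable G g h"
    then show "S_at G (g\<^sup>\<star>) = Fstar G (S_at G g)"
      by (intro S_at_star) (simp add: composable_def)
    show "S_at G (g \<cdot> h) = up_closure G (Fmult G (S_at G g) (S_at G h))"
      using gh by (rule S_at_mult)
  qed (rule up_closure_Fmult)
qed

end
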